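(* Let $X$ be a real Banach space with $\dim X\ge2$. If $-\infty\le t\le1$, then $$C^B_t(X)\le\sup_{0\le\tau\le1}\frac{\bigl(1+\rho_B(\tau;X)\bigr)^2}{1+\tau^2}.$$ In particular, if $0\le L\le1$ and $\rho_B(\tau;X)\le L\tau$ for all $0\le\tau\le1$, then $$C^B_t(X)\le1+L^2.$$
   Context: $S_X$ denotes the unit sphere of $X$. For $x,y\in X$, Birkhoff-James orthogonality $x\perp_B y$ means $\|x+\lambda y\|\ge\|x\|$ for all $\lambda\in\mathbb{R}$. For $a,b>0$ set $M_t(a,b)=\left(\frac{a^t+b^t}{2}\right)^{1/t}$ if $t\in\mathbb{R}\setminus\{0\}$, $M_0(a,b)=\sqrt{ab}$, and $M_{-\infty}(a,b)=\min\{a,b\}$. For $\tau\ge 0$ define $$J^B_{X,t}(\tau)=\sup\{M_t(\|x+\tau y\|,\|x-\tau y\|): x,y\in S_X,\ x\perp_B y\},\qquad C^B_t(X)=\sup_{0\le\tau\le1}\frac{J^B_{X,t}(\tau)^2}{1+\tau^2},$$ $$\rho_B(\tau;X)=\sup\left\{\frac{\|x+\tau y\|+\|x-\tau y\|}{2}-1:x,y\in S_X,\ x\perp_B y\right\}.$$ *)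

theory Defs
  imports "HOL-Analysis.Analysis"
begin

definition birkhoff_orth :: "'a::real_normed_vector \<Rightarrow> 'a \<Rightarrow> bool"  (infix "\<bottom>\<^sub>B" 50)
  where "x \<bottom>\<^sub>B y \<longleftrightarrow> (\<forall>l::real. norm (x + l *\<^sub>R y) \<ge> norm x)"

text \<open>
  Power mean of two positive reals. The order ranges over \<^typ>\<open>ereal\<close> so that it may be
  \<open>-\<infinity>\<close>; the value at \<open>\<infinity>\<close> only makes the function total.
\<close>

definition power_mean :: "ereal \<Rightarrow> real \<Rightarrow> real \<Rightarrow> real"
  where "power_mean t a b =
    (if t = -\<infinity> then min a b
     else if t = \<infinity> then max a b
     else if t = 0 then sqrt (a * b)
     else ((a powr real_of_ereal t + b powr real_of_ereal t) / 2) powr (1 / real_of_ereal t))"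

text \<open>
  The space \<open>X\<close> is the type \<open>'a\<close>, passed as a type token. The suprema are taken in \<^typ>\<open>real\<close>,
  where they are meaningful only for nonempty sets that are bounded above. If \<open>x\<close>, \<open>y\<close> are unit
  vectors with \<open>x \<bottom>\<^sub>B y\<close> and \<open>\<tau> \<ge> 0\<close>, both norms lie in \<open>[1, 1 + \<tau>]\<close>, hence so do
  their means, which gives boundedness; nonemptiness, that is the existence of such a pair, needs
  dimension at least two.
\<close>

definition JB :: "'a::real_normed_vector itself \<Rightarrow> ereal \<Rightarrow> real \<Rightarrow> real"
  where "JB X t \<tau> =
    Sup {power_mean t (norm (x + \<tau> *\<^sub>R y)) (norm (x - \<tau> *\<^sub>R y)) | x y :: 'a.
           x \<in> sphere 0 1 \<and> y \<in> sphere 0 1 \<and> x \<bottom>\<^sub>B y}"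

definition CB :: "'a::real_normed_vector itself \<Rightarrow> ereal \<Rightarrow> real"
  where "CB X t = (SUP \<tau>\<in>{0..1}. (JB X t \<tau>)\<^sup>2 / (1 + \<tau>\<^sup>2))"

definition rhoB :: "'a::real_normed_vector itself \<Rightarrow> real \<Rightarrow> real"
  where "rhoB X \<tau> =
    Sup {(norm (x + \<tau> *\<^sub>R y) + norm (x - \<tau> *\<^sub>R y)) / 2 - 1 | x y :: 'a.
           x \<in> sphere 0 1 \<and> y \<in> sphere 0 1 \<and> x \<bottom>\<^sub>B y}"

end

theory Submission
  imports Defs
begin

text \<open>
  For \<open>t \<le> 1\<close> the power mean is dominated by the arithmetic mean, so
  \<open>J\<^sup>B\<^sub>X\<^sub>,\<^sub>t(\<tau>) \<le> 1 + \<rho>\<^sub>B(\<tau>; X)\<close> for each \<open>\<tau>\<close>; the linear bound then follows from the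
  Cauchy-Schwarz inequality \<open>(1 + L\<tau>)\<^sup>2 \<le> (1 + L\<^sup>2)(1 + \<tau>\<^sup>2)\<close>. Dimension at least two is needed only
  for the suprema to range over nonempty sets: if \<open>z\<close> is the difference between a vector outside
  the line through \<open>y\<close> and a nearest point of that line, then \<open>z\<close> is orthogonal to \<open>y\<close>.
\<close>

text \<open>The hypothesis is the sign of the second derivative. It covers \<open>p \<ge> 1\<close>
  and \<open>p \<le> 0\<close> at once, the ranges of \<open>1 / s\<close> for 0 < s \<le> 1 and for
  s < 0.\<close>

lemma powr_convex_nonneg_curvature:
  fixes p :: real
  assumes "p * (p - 1) \<ge> 0"
  shows "convex_on {0<..} (\<lambda>x. x powr p)"
proof (rule f''_ge0_imp_convex)
  fix x :: real assume x: "x \<in> {0<..}"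
  show "((\<lambda>x. x powr p) has_real_derivative p * x powr (p - 1)) (at x)"
    using x by (auto intro!: derivative_eq_intros)
  show "((\<lambda>x. p * x powr (p - 1)) has_real_derivative p * (p - 1) * x powr (p - 2)) (at x)"
    using x by (auto intro!: derivative_eq_intros)
  show "p * (p - 1) * x powr (p - 2) \<ge> 0"
    using assms by simp
qed simp

text \<open>Midpoint convexity of \<open>x powr (1 / s)\<close> at the points
  \<open>a powr s\<close> and \<open>b powr s\<close>, whose images are \<open>a\<close> and
  \<open>b\<close>.\<close>

lemma powr_mean_le_arith_mean:
  fixes a b s :: real
  assumes "a > 0" "b > 0" "s \<le> 1" "s \<noteq> 0"
  shows "((a powr s + b powr s) / 2) powr (1 / s) \<le> (a + b) / 2"
proof -
  have "(1 / s) * (1 / s - 1) = (1 - s) / s\<^sup>2"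
    using assms by (simp add: field_simps power2_eq_square)
  then have "convex_on {0<..} (\<lambda>x::real. x powr (1 / s))"
    using assms by (intro powr_convex_nonneg_curvature) simp
  from convex_onD[OF this, of "1/2" "a powr s" "b powr s"] assms
  show ?thesis
    by (simp add: powr_powr field_simps)
qed

lemma power_mean_le_arith_mean:
  assumes "a > 0" "b > 0" "t \<le> 1"
  shows "power_mean t a b \<le> (a + b) / 2"
proof (cases t)
  \<comment> \<open>A finite order is either 0, settled by AM-GM, or falls under the convexity
    bound. Order -\<infinity> gives the minimum, and \<infinity> is excluded by
    \<open>t \<le> 1\<close>.\<close>
  case (real r)
  then show ?thesis
    using assms arith_geo_mean_sqrt[of a b] powr_mean_le_arith_mean[of a b r]
    by (auto simp: power_mean_def zero_ereal_def one_ereal_def)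
qed (use assms in \<open>auto simp: power_mean_def\<close>)

lemma power_mean_nonneg:
  assumes "a \<ge> 0" "b \<ge> 0"
  shows "power_mean t a b \<ge> 0"
  using assms by (auto simp: power_mean_def le_max_iff_disj)

lemma birkhoff_orth_scaleR:
  assumes "x \<bottom>\<^sub>B y"
  shows "(c *\<^sub>R x) \<bottom>\<^sub>B y"
proof (cases "c = 0")
  case False
  show ?thesis
    unfolding birkhoff_orth_def
  proof
    fix l
    have "norm (c *\<^sub>R x) = \<bar>c\<bar> * norm x"
      by simp
    also have "\<dots> \<le> \<bar>c\<bar> * norm (x + (l / c) *\<^sub>R y)"
      using assms by (intro mult_left_mono) (auto simp: birkhoff_orth_def)
    also have "\<dots> = norm (c *\<^sub>R (x + (l / c) *\<^sub>R y))"
      by simp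
    also have "c *\<^sub>R (x + (l / c) *\<^sub>R y) = c *\<^sub>R x + l *\<^sub>R y"
      using False by (simp add: scaleR_add_right)
    finally show "norm (c *\<^sub>R x) \<le> norm (c *\<^sub>R x + l *\<^sub>R y)" .
  qed
qed (simp add: birkhoff_orth_def)

lemma exists_birkhoff_orth_to_unit:
  fixes v y :: "'a::real_normed_vector"
  assumes "norm y = 1"
  obtains c where "(v - c *\<^sub>R y) \<bottom>\<^sub>B y"
proof -
  \<comment> \<open>For \<open>d\<close> outside \<open>?I\<close> the reverse triangle inequality
    gives \<open>?f d \<ge> \<bar>d\<bar> - norm v \<ge> norm v = ?f 0\<close>, so a minimum over
    this compact interval is global.\<close>
  let ?f = "\<lambda>c. norm (v - c *\<^sub>R y)" and ?I = "{- 2 * norm v..2 * norm v}"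
  have "continuous_on ?I ?f"
    by (intro continuous_intros)
  then have "\<exists>c\<in>?I. \<forall>d\<in>?I. ?f c \<le> ?f d"
    by (intro continuous_attains_inf) auto
  then obtain c where c: "\<And>d. d \<in> ?I \<Longrightarrow> ?f c \<le> ?f d"
    by blast
  have min: "?f c \<le> ?f d" for d
  proof (cases "d \<in> ?I")
    case False
    have "?f c \<le> norm v"
      using c[of 0] by simp
    also have "\<dots> \<le> \<bar>d\<bar> - norm v"
      using False by auto
    also have "\<dots> \<le> ?f d"
      using norm_triangle_ineq2[of "d *\<^sub>R y" v] assms by (simp add: norm_minus_commute)
    finally show ?thesis .
  qed (use c in blast)
  have "(v - c *\<^sub>R y) \<bottom>\<^sub>B y"
    unfolding birkhoff_orth_def
  proof
    fix l
    show "?f c \<le> norm (v - c *\<^sub>R y + l *\<^sub>R y)"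
      using min[of "c - l"] by (simp add: algebra_simps)
  qed
  then show thesis
    by (rule that)
qed

lemma exists_birkhoff_orth_unit_pair:
  assumes "\<exists>B :: 'a::real_normed_vector set. independent B \<and> card B = 2"
  obtains x y :: "'a::real_normed_vector" where "norm x = 1" "norm y = 1" "x \<bottom>\<^sub>B y"
proof -
  obtain u v :: 'a where uv: "u \<noteq> v" "independent {u, v}"
    using assms by (auto simp: card_2_iff)
  have "u \<noteq> 0"
    using uv dependent_zero by blast
  define y where "y = u /\<^sub>R norm u"
  have y: "norm y = 1"
    using \<open>u \<noteq> 0\<close> by (simp add: y_def)
  obtain c where c: "(v - c *\<^sub>R y) \<bottom>\<^sub>B y"
    using exists_birkhoff_orth_to_unit[OF y] .
  define z where "z = v - c *\<^sub>R y"
  \<comment> \<open>Independence keeps \<open>v\<close> off the line through \<open>y\<close>, so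
    \<open>z\<close> is nonzero and can be normalised; rescaling the left argument preserves
    orthogonality.\<close>
  have "v \<notin> span {u}"
    using uv by (simp add: independent_insert insert_commute[of u v])
  moreover have "c *\<^sub>R y \<in> span {u}"
    by (simp add: y_def span_base span_scale)
  ultimately have "z \<noteq> 0"
    by (auto simp: z_def)
  then have "norm (z /\<^sub>R norm z) = 1"
    by simp
  with that y birkhoff_orth_scaleR c show thesis
    unfolding z_def by blast
qed

lemma JB_bounds:
  fixes t :: ereal
  assumes dim: "\<exists>B :: 'a::real_normed_vector set. independent B \<and> card B = 2"
    and "t \<le> 1" "\<tau> \<ge> 0"
  shows JB_nonneg: "0 \<le> JB TYPE('a) t \<tau>"
    and JB_le_rhoB: "JB TYPE('a) t \<tau> \<le> 1 + rhoB TYPE('a) \<tau>"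
    and rhoB_le: "rhoB TYPE('a) \<tau> \<le> \<tau>"
proof -
  let ?S = "{(x, y). norm x = 1 \<and> norm y = 1 \<and> x \<bottom>\<^sub>B (y::'a)}"
  define M where "M = (\<lambda>(x::'a, y). power_mean t (norm (x + \<tau> *\<^sub>R y)) (norm (x - \<tau> *\<^sub>R y)))"
  define A where "A = (\<lambda>(x::'a, y). (norm (x + \<tau> *\<^sub>R y) + norm (x - \<tau> *\<^sub>R y)) / 2 - 1)"
  have JB: "JB TYPE('a) t \<tau> = Sup (M ` ?S)"
    unfolding JB_def M_def by (rule arg_cong[where f = Sup]) (auto simp: image_iff)
  have rho: "rhoB TYPE('a) \<tau> = Sup (A ` ?S)"
    unfolding rhoB_def A_def by (rule arg_cong[where f = Sup]) (auto simp: image_iff)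
  obtain p where p: "p \<in> ?S"
    using exists_birkhoff_orth_unit_pair[OF dim] by blast
  \<comment> \<open>Besides giving \<open>rhoB_le\<close>, this bounds the set under the real
    supremum, so that each \<open>A q\<close> is at most \<open>rhoB\<close>.\<close>
  have A: "A q \<le> \<tau>" if S: "q \<in> ?S" for q
  proof -
    obtain x y where q: "q = (x, y)" "norm x = 1" "norm y = 1"
      using S by auto
    then show ?thesis
      using norm_triangle_ineq[of x "\<tau> *\<^sub>R y"] norm_triangle_ineq4[of x "\<tau> *\<^sub>R y"] \<open>\<tau> \<ge> 0\<close>
      by (simp add: A_def field_simps)
  qed
  then have bdd_A: "bdd_above (A ` ?S)"
    by (rule bdd_aboveI2)
  have M: "0 \<le> M q \<and> M q \<le> 1 + A q" if S: "q \<in> ?S" for q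
  proof -
    obtain x y where q: "q = (x, y)" and x: "norm x = 1" and xy: "x \<bottom>\<^sub>B y"
      using S by auto
    \<comment> \<open>Orthogonality is used at \<open>l = \<tau>\<close> and
      \<open>l = -\<tau>\<close>; it makes both norms positive, as the comparison of means
      requires.\<close>
    have "norm (x + \<tau> *\<^sub>R y) \<ge> 1" "norm (x - \<tau> *\<^sub>R y) \<ge> 1"
      using xy x unfolding birkhoff_orth_def
      by (metis, metis scaleR_minus_left add_uminus_conv_diff)
    then have "norm (x + \<tau> *\<^sub>R y) > 0" "norm (x - \<tau> *\<^sub>R y) > 0"
      by linarith+
    from power_mean_nonneg[OF this[THEN less_imp_le]] power_mean_le_arith_mean[OF this \<open>t \<le> 1\<close>]
    show ?thesis
      by (simp add: M_def A_def q)
  qed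
  show rho_le: "rhoB TYPE('a) \<tau> \<le> \<tau>"
    unfolding rho using p A by (intro cSUP_least) blast+
  have le: "M q \<le> 1 + rhoB TYPE('a) \<tau>" if "q \<in> ?S" for q
    using M[OF that] cSUP_upper[OF that bdd_A] by (simp add: rho)
  show "JB TYPE('a) t \<tau> \<le> 1 + rhoB TYPE('a) \<tau>"
    unfolding JB using p le by (intro cSUP_least) blast+
  have "bdd_above (M ` ?S)"
    using le by (rule bdd_aboveI2)
  from cSUP_upper[OF p this] M[OF p] show "0 \<le> JB TYPE('a) t \<tau>"
    by (simp add: JB)
qed

lemma square_div_le_of_le_linear:
  fixes j L \<tau> :: real
  assumes "0 \<le> j" "j \<le> 1 + L * \<tau>"
  shows "j\<^sup>2 / (1 + \<tau>\<^sup>2) \<le> 1 + L\<^sup>2"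
proof -
  have "j\<^sup>2 \<le> (1 + L * \<tau>)\<^sup>2"
    using assms by (intro power_mono)
  \<comment> \<open>The added square is the defect in the Cauchy-Schwarz inequality for the vectors
    (1, L) and (1, \<tau>), by Lagrange's identity.\<close>
  also have "\<dots> \<le> (1 + L * \<tau>)\<^sup>2 + (L - \<tau>)\<^sup>2"
    by simp
  also have "\<dots> = (1 + L\<^sup>2) * (1 + \<tau>\<^sup>2)"
    by (simp add: power2_eq_square algebra_simps)
  finally show ?thesis
    by (simp add: divide_le_eq add_pos_nonneg)
qed

theorem proposition12:
  fixes t :: ereal
  assumes dim_ge_2: "\<exists>B :: 'a::banach set. independent B \<and> card B = 2"
    and t: "-\<infinity> \<le> t" "t \<le> 1"
  shows "CB TYPE('a) t \<le> (SUP \<tau>\<in>{0..1}. (1 + rhoB TYPE('a) \<tau>)\<^sup>2 / (1 + \<tau>\<^sup>2)) \<and>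
    (\<forall>L::real. 0 \<le> L \<and> L \<le> 1 \<and> (\<forall>\<tau>\<in>{0..1}. rhoB TYPE('a) \<tau> \<le> L * \<tau>)
       \<longrightarrow> CB TYPE('a) t \<le> 1 + L\<^sup>2)"
proof (intro conjI allI impI)
  note bounds = JB_bounds[OF dim_ge_2 t(2)]
  let ?g = "\<lambda>\<tau>. (1 + rhoB TYPE('a) \<tau>)\<^sup>2 / (1 + \<tau>\<^sup>2)"
  \<comment> \<open>The trivial bound \<open>rhoB \<le> \<tau>\<close> is the linear bound with L =
    1. It makes the right-hand supremum one over a set bounded above.\<close>
  have "?g \<tau> \<le> 1 + 1\<^sup>2" if "\<tau> \<in> {0..1}" for \<tau>
    using that bounds[of \<tau>] by (intro square_div_le_of_le_linear) auto
  then have bdd: "bdd_above (?g ` {0..1})"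
    by (rule bdd_aboveI2)
  show "CB TYPE('a) t \<le> (SUP \<tau>\<in>{0..1}. ?g \<tau>)"
    unfolding CB_def
  proof (rule cSUP_mono[OF _ bdd])
    fix \<tau> :: real assume \<tau>: "\<tau> \<in> {0..1}"
    then have "(JB TYPE('a) t \<tau>)\<^sup>2 / (1 + \<tau>\<^sup>2) \<le> ?g \<tau>"
      using bounds[of \<tau>] by (intro divide_right_mono power_mono) auto
    with \<tau> show "\<exists>\<sigma>\<in>{0..1}. (JB TYPE('a) t \<tau>)\<^sup>2 / (1 + \<tau>\<^sup>2) \<le> ?g \<sigma>"
      by blast
  qed simp
  fix L :: real
  assume L: "0 \<le> L \<and> L \<le> 1 \<and> (\<forall>\<tau>\<in>{0..1}. rhoB TYPE('a) \<tau> \<le> L * \<tau>)"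
  show "CB TYPE('a) t \<le> 1 + L\<^sup>2"
    unfolding CB_def
  proof (rule cSUP_least)
    fix \<tau> :: real assume \<tau>: "\<tau> \<in> {0..1}"
    \<comment> \<open>Here \<open>JB\<close> plays the role of \<open>j\<close>: it is nonnegative
      and at most \<open>1 + rhoB\<close>, hence at most 1 + L\<tau>.\<close>
    then show "(JB TYPE('a) t \<tau>)\<^sup>2 / (1 + \<tau>\<^sup>2) \<le> 1 + L\<^sup>2"
      using bounds[of \<tau>] L by (intro square_div_le_of_le_linear) force+
  qed simp
qed

end
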